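(* For an integer $q\ge2$ let $\nu(q)$ be the number of vectors $(b_1,\dots,b_{q-1})\in\{0,1,\dots,255\}^{q-1}$ such that $\sum_{1\le j<q}b_j^2\equiv 1\pmod 4$. Then $$\nu(2)=2^{7},\quad \nu(3)=2^{15},\quad \nu(4)=3\cdot2^{21},\quad \nu(5)=2^{30},\quad \nu(6)=3\cdot 2^{36},\quad \nu(7)=3\cdot 2^{44},$$ $$\nu(8)=7\cdot 2^{51},\quad \nu(9)=2^{62},\quad \nu(10)=17\cdot 2^{66},\quad \nu(11)=17\cdot 2^{74},\quad \nu(12)=3\cdot 11\cdot 2^{81},\quad \nu(13)=2^{94}.$$ *)

theory Defs
  imports "HOL-Library.FuncSet" "HOL-Number_Theory.Cong"
begin

text \<open>
  A vector \<open>(b\<^sub>1, \<dots>, b\<^bsub>q-1\<^esub>)\<close> is an extensional function on the index set \<open>{1..<q}\<close>,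
  so distinct elements of the function space are distinct vectors. Only \<open>q \<ge> 2\<close> is of interest.
\<close>

definition nu :: "nat \<Rightarrow> nat" where
  "nu q = card {b \<in> {1..<q} \<rightarrow>\<^sub>E {0..255::nat}. [(\<Sum>j\<in>{1..<q}. (b j)\<^sup>2) = 1] (mod 4)}"

end

theory Submission imports Defs begin

text \<open>
  A square is \<open>0\<close> or \<open>1\<close> modulo \<open>4\<close> according to the parity of its root, so the sum of squares
  of a vector is congruent to the number of its odd entries
  (\<open>sum_squares_cong_card_odd\<close>). Exactly half of the 256 admissible values are odd. Hence every
  set of positions is the set of odd positions of equally many vectors, namely of \<open>128 ^ n\<close>
  vectors of length \<open>n\<close> (\<open>card_PiE_prescribed_positions\<close>), and it remains to count the sets of
  positions whose size is \<open>1\<close> modulo \<open>4\<close>. This gives the formula \<open>nu_Suc\<close>, which is evaluated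
  for \<open>n = 1, \<dots>, 12\<close>.
\<close>

lemma sum_squares_cong_card_odd:
  fixes f :: "'a \<Rightarrow> nat"
  assumes "finite I"
  shows "[(\<Sum>i\<in>I. (f i)\<^sup>2) = card {i \<in> I. odd (f i)}] (mod 4)"
proof -
  have square: "[m\<^sup>2 = (if odd m then 1 else 0)] (mod 4)" for m :: nat
  proof (cases "even m")
    case True
    then show ?thesis
      by (auto elim!: evenE simp: cong_def power2_eq_square)
  next
    case False
    then obtain k where "m = 2 * k + 1"
      by (rule oddE)
    then have "m\<^sup>2 = 1 + 4 * (k\<^sup>2 + k)"
      by (simp add: power2_eq_square algebra_simps)
    then show ?thesis
      using False by (simp add: cong_def del: distrib_left_numeral)
  qed
  have "[(\<Sum>i\<in>I. (f i)\<^sup>2) = (\<Sum>i\<in>I. if odd (f i) then 1 else 0)] (mod 4)"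
    by (intro cong_sum square)
  also have "(\<Sum>i\<in>I. if odd (f i) then 1 else 0) = card {i \<in> I. odd (f i)}"
    using assms by (simp add: sum.If_cases Int_def)
  finally show ?thesis .
qed

text \<open>
  Prescribing the positions at which \<open>P\<close> holds constrains each coordinate separately, so the
  vectors in question form a product again.
\<close>

lemma card_PiE_prescribed_positions:
  assumes "finite I" and "J \<subseteq> I"
  shows "card {b \<in> I \<rightarrow>\<^sub>E A. {i \<in> I. P (b i)} = J} =
    card {a \<in> A. P a} ^ card J * card {a \<in> A. \<not> P a} ^ (card I - card J)"
proof -
  have "{b \<in> I \<rightarrow>\<^sub>E A. {i \<in> I. P (b i)} = J} =
      (\<Pi>\<^sub>E i\<in>I. if i \<in> J then {a \<in> A. P a} else {a \<in> A. \<not> P a})"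
    using assms(2) by (fastforce simp: PiE_iff split: if_splits)
  then have "card {b \<in> I \<rightarrow>\<^sub>E A. {i \<in> I. P (b i)} = J} =
      (\<Prod>i\<in>I. if i \<in> J then card {a \<in> A. P a} else card {a \<in> A. \<not> P a})"
    using assms(1) by (simp add: card_PiE if_distrib cong: if_cong)
  also have "\<dots> = card {a \<in> A. P a} ^ card J * card {a \<in> A. \<not> P a} ^ card (I - J)"
  proof -
    have "I \<inter> {i. i \<in> J} = J" "I \<inter> - {i. i \<in> J} = I - J"
      using assms(2) by auto
    then show ?thesis
      using assms(1) by (simp add: prod.If_cases)
  qed
  also have "card (I - J) = card I - card J"
    using assms by (simp add: card_Diff_subset finite_subset)
  finally show ?thesis .
qed

lemma card_subsets_card_in:
  assumes "finite I"
  shows "card {J. J \<subseteq> I \<and> Q (card J)} = (\<Sum>k\<le>card I. if Q k then card I choose k else 0)"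
proof -
  let ?K = "{k. k \<le> card I \<and> Q k}"
  have "{J. J \<subseteq> I \<and> Q (card J)} = (\<Union>k\<in>?K. {J. J \<subseteq> I \<and> card J = k})"
    using card_mono[OF assms] by auto
  also have "card \<dots> = (\<Sum>k\<in>?K. card {J. J \<subseteq> I \<and> card J = k})"
    using assms by (intro card_UN_disjoint) auto
  also have "\<dots> = (\<Sum>k\<in>?K. card I choose k)"
    using n_subsets[OF assms] by simp
  also have "\<dots> = (\<Sum>k\<le>card I. if Q k then card I choose k else 0)"
    by (simp add: sum.inter_filter[symmetric])
  finally show ?thesis .
qed

lemma card_odd_bytes: "card {a \<in> {0..255}. odd (a::nat)} = 128"
proof -
  have "{a \<in> {0..255}. odd (a::nat)} = (\<lambda>k. 2 * k + 1) ` {..<128}"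
    by (auto elim!: oddE)
  then show ?thesis
    by (simp add: card_image inj_on_def)
qed

lemma card_even_bytes: "card {a \<in> {0..255}. \<not> odd (a::nat)} = 128"
proof -
  have "{a \<in> {0..255}. \<not> odd (a::nat)} = (\<lambda>k. 2 * k) ` {..<128}"
    by (auto elim!: evenE)
  then show ?thesis
    by (simp add: card_image inj_on_def)
qed

lemma nu_Suc: "nu (Suc n) = 128 ^ n * (\<Sum>k\<le>n. if k mod 4 = 1 then n choose k else 0)"
proof -
  let ?I = "{1..<Suc n}" and ?A = "{0..255::nat}"
  let ?odds = "\<lambda>b. {i \<in> ?I. odd (b i :: nat)}"
  let ?Js = "{J. J \<subseteq> ?I \<and> card J mod 4 = 1}"
  have "[(\<Sum>j\<in>?I. (b j)\<^sup>2) = 1] (mod 4) \<longleftrightarrow> card (?odds b) mod 4 = 1" for b :: "nat \<Rightarrow> nat"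
    using sum_squares_cong_card_odd[of ?I b] by (simp add: cong_def)
  then have "nu (Suc n) = card {b \<in> ?I \<rightarrow>\<^sub>E ?A. card (?odds b) mod 4 = 1}"
    unfolding nu_def by presburger
  also have "{b \<in> ?I \<rightarrow>\<^sub>E ?A. card (?odds b) mod 4 = 1} =
      (\<Union>J\<in>?Js. {b \<in> ?I \<rightarrow>\<^sub>E ?A. ?odds b = J})"
    by auto
  also have "card \<dots> = (\<Sum>J\<in>?Js. card {b \<in> ?I \<rightarrow>\<^sub>E ?A. ?odds b = J})"
  proof (rule card_UN_disjoint)
    have "finite (?I \<rightarrow>\<^sub>E ?A)"
      by (simp add: finite_PiE)
    then show "\<forall>J\<in>?Js. finite {b \<in> ?I \<rightarrow>\<^sub>E ?A. ?odds b = J}"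
      by simp
  qed auto
  also have "\<dots> = (\<Sum>J\<in>?Js. 128 ^ n)"
  proof (rule sum.cong)
    fix J assume "J \<in> ?Js"
    then have J: "J \<subseteq> ?I"
      by simp
    then have "card J \<le> n"
      using card_mono[of ?I J] by simp
    then show "card {b \<in> ?I \<rightarrow>\<^sub>E ?A. ?odds b = J} = 128 ^ n"
      using card_PiE_prescribed_positions[OF finite_atLeastLessThan J, of ?A odd]
      unfolding card_odd_bytes card_even_bytes
      by (simp flip: power_add)
  qed simp
  also have "\<dots> = 128 ^ n * card ?Js"
    by simp
  also have "card ?Js = (\<Sum>k\<le>n. if k mod 4 = 1 then n choose k else 0)"
    using card_subsets_card_in[of ?I "\<lambda>k. k mod 4 = 1"]
    unfolding card_atLeastLessThan diff_Suc_1 by simp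
  finally show ?thesis .
qed

theorem mainTheorem4:
  shows "nu 2 = 2 ^ 7 \<and> nu 3 = 2 ^ 15 \<and> nu 4 = 3 * 2 ^ 21 \<and> nu 5 = 2 ^ 30
    \<and> nu 6 = 3 * 2 ^ 36 \<and> nu 7 = 3 * 2 ^ 44 \<and> nu 8 = 7 * 2 ^ 51 \<and> nu 9 = 2 ^ 62
    \<and> nu 10 = 17 * 2 ^ 66 \<and> nu 11 = 17 * 2 ^ 74 \<and> nu 12 = 3 * 11 * 2 ^ 81 \<and> nu 13 = 2 ^ 94"
proof -
  have nu_closed_form: "nu q = 128 ^ (q - 1) * (\<Sum>k\<le>q - 1. if k mod 4 = 1 then (q - 1) choose k else 0)"
    if "q > 0" for q
    using nu_Suc[of "q - 1"] that by simp
  show ?thesis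
    by (simp add: nu_closed_form atMost_nat_numeral binomial_code fact_numeral fold_atLeastAtMost_nat.simps)
qed

end
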